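(* Let $G=(V,E)$ be a connected graph and let $uu',vv'\in E$ be such that $u,u',v,v'$ are pairwise distinct. Then the inequality $x_{uv}+x_{u'v'}\le x_{uv'}+x_{vu'}$ is valid and facet-defining for $\mathrm{LMC}(G)$ if and only if $\{u,v'\}$ is a $vu'$-separating node set and $\{v,u'\}$ is a $uv'$-separating node set.
   Context: Graphs are finite, simple, undirected; $ab$ denotes $\{a,b\}$. A set $S\subseteq V$ is $ab$-separating if every $ab$-path in $G$ contains at least one node of $S$. A decomposition of $G$ is a partition of $V$ each of whose blocks induces a connected subgraph of $G$; its lifted multicut is the set of pairs $ab\in\binom{V}{2}$ with $a,b$ in distinct blocks. $\mathrm{LMC}(G)\subseteq\mathbb{R}^{\binom{V}{2}}$ is the convex hull of the characteristic vectors of these lifted multicuts over all decompositions of $G$. *)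

theory Defs
  imports "HOL-Analysis.Analysis" "HOL-Library.Disjoint_Sets"
begin

definition node_pairs :: "'a set \<Rightarrow> 'a set set" where
  "node_pairs V = {e. e \<subseteq> V \<and> card e = 2}"

definition simple_graph :: "'a set \<Rightarrow> 'a set set \<Rightarrow> bool" where
  "simple_graph V E \<longleftrightarrow> finite V \<and> E \<subseteq> node_pairs V"

definition path_between :: "'a set \<Rightarrow> 'a set set \<Rightarrow> 'a \<Rightarrow> 'a \<Rightarrow> 'a list \<Rightarrow> bool" where
  "path_between V E a b p \<longleftrightarrow>
     p \<noteq> [] \<and> hd p = a \<and> last p = b \<and> set p \<subseteq> V \<and> distinct p \<and>
     successively (\<lambda>x y. {x, y} \<in> E) p"

definition connected_graph :: "'a set \<Rightarrow> 'a set set \<Rightarrow> bool" where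
  "connected_graph V E \<longleftrightarrow> (\<forall>a\<in>V. \<forall>b\<in>V. \<exists>p. path_between V E a b p)"

definition separating :: "'a set \<Rightarrow> 'a set set \<Rightarrow> 'a \<Rightarrow> 'a \<Rightarrow> 'a set \<Rightarrow> bool" where
  "separating V E a b S \<longleftrightarrow>
     S \<subseteq> V \<and> (\<forall>p. path_between V E a b p \<longrightarrow> set p \<inter> S \<noteq> {})"

definition induced_edges :: "'a set set \<Rightarrow> 'a set \<Rightarrow> 'a set set" where
  "induced_edges E U = {e \<in> E. e \<subseteq> U}"

definition decomposition :: "'a set \<Rightarrow> 'a set set \<Rightarrow> 'a set set \<Rightarrow> bool" where
  "decomposition V E P \<longleftrightarrow>
     partition_on V P \<and> (\<forall>U\<in>P. connected_graph U (induced_edges E U))"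

definition lifted_multicut :: "'a set \<Rightarrow> 'a set set \<Rightarrow> 'a set set" where
  "lifted_multicut V P =
     {{a, b} | a b. {a, b} \<in> node_pairs V \<and> (\<exists>A\<in>P. \<exists>B\<in>P. A \<noteq> B \<and> a \<in> A \<and> b \<in> B)}"

text \<open>
  The space of real vectors indexed by the 2-element subsets of \<open>V\<close> is realised as the coordinate
  subspace of \<^typ>\<open>real ^ ('a set)\<close> in which every coordinate whose index is not in \<open>node_pairs V\<close>
  vanishes. Convex hulls, faces and affine dimension do not depend on the ambient space.
\<close>

definition char_vec :: "'a::finite set set \<Rightarrow> real ^ ('a set)" where
  "char_vec F = (\<chi> e. indicator F e)"

definition LMC :: "'a::finite set \<Rightarrow> 'a set set \<Rightarrow> (real ^ ('a set)) set" where
  "LMC V E = convex hull {char_vec (lifted_multicut V P) | P. decomposition V E P}"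

end

theory Submission
  imports Defs
begin

text \<open>
  Write \<open>k(U)\<close> for the characteristic vector of the pairs inside \<open>U\<close>. The multicut vector of a
  decomposition is \<open>k(V)\<close> minus the sum of \<open>k(U)\<close> over its blocks, so everything reduces to the
  values of the linear form \<open>f x = x\<^bsub>uv\<^esub> + x\<^bsub>u'v'\<^esub> - x\<^bsub>uv'\<^esub> - x\<^bsub>vu'\<^esub>\<close> on \<open>k(U)\<close> for connected \<open>U\<close>.
  The separation conditions say exactly that \<open>f (k(U)) \<ge> 0\<close> for all of them, and then \<open>f (k(U)) = 0\<close>
  unless \<open>U\<close> meets the four nodes in \<open>{u, v}\<close> or in \<open>{u', v'}\<close>.

  For the dimension, let \<open>F\<close> be the face. If \<open>U\<close> meets the four nodes in \<open>{u, v}\<close>, then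
  \<open>k(U + u' + v') - k(U + u') - k(U + v') + k(U)\<close> is the unit vector of \<open>u'v'\<close> and all terms but
  the last lie in the span of \<open>F\<close>; the other case is symmetric. The same identity along a path
  from \<open>u'\<close> to \<open>v'\<close> links the two unit vectors, so \<open>F\<close> and one unit vector span everything.
  The face is proper because the identity along any path from \<open>u\<close> to \<open>v\<close> puts the unit vector
  of \<open>uv\<close>, on which \<open>f = 1\<close>, into the span of the polytope.
\<close>

abbreviation connected_set :: "'a set set \<Rightarrow> 'a set \<Rightarrow> bool" where
  "connected_set E U \<equiv> connected_graph U (induced_edges E U)"

definition clique_vec :: "'a::finite set \<Rightarrow> real ^ ('a set)" where
  "clique_vec U = char_vec (node_pairs U)"

section \<open>Paths and connected node sets\<close>

lemma path_between_mono:
  assumes "path_between U E a b p" and "U \<subseteq> V" and "E \<subseteq> F"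
  shows "path_between V F a b p"
  using assms unfolding path_between_def by (auto elim!: successively_mono)

lemma path_between_rev:
  assumes "path_between V E a b p"
  shows "path_between V E b a (rev p)"
  using assms unfolding path_between_def
  by (auto simp: hd_rev last_rev insert_commute)

lemma connected_set_empty: "connected_set E {}"
  by (simp add: connected_graph_def)

lemma path_between_singleton: "a \<in> V \<Longrightarrow> path_between V E a a [a]"
  by (simp add: path_between_def)

lemma connected_set_singleton: "connected_set E {x}"
  using path_between_singleton[of x "{x}"] by (auto simp: connected_graph_def)

lemma connected_set_insert:
  assumes "connected_set E U" and "w \<in> U" and "{x, w} \<in> E"
  shows "connected_set E (insert x U)"
proof (cases "x \<in> U")
  case True
  then show ?thesis using assms by (simp add: insert_absorb)
next
  case False
  let ?path = "path_between (insert x U) (induced_edges E (insert x U))"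
  have lift: "?path a b p" if "path_between U (induced_edges E U) a b p" for a b p
    using that by (rule path_between_mono) (auto simp: induced_edges_def)
  have old: "\<exists>p. ?path a b p" if "a \<in> U" "b \<in> U" for a b
    using assms(1) that lift unfolding connected_graph_def by blast
  have new: "\<exists>p. ?path x b p" if b: "b \<in> U" for b
  proof -
    obtain p where p: "path_between U (induced_edges E U) w b p"
      using assms(1,2) b unfolding connected_graph_def by blast
    then have "x \<notin> set p"
      using False by (auto simp: path_between_def)
    moreover have "{x, w} \<in> induced_edges E (insert x U)"
      using assms by (auto simp: induced_edges_def)
    ultimately have "?path x b (x # p)"
      using lift[OF p] by (simp add: path_between_def successively_Cons)
    then show ?thesis by blast
  qed
  show ?thesis
    unfolding connected_graph_def
  proof (intro ballI)
    fix a b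
    assume "a \<in> insert x U" "b \<in> insert x U"
    then consider "a \<in> U" "b \<in> U" | "a = x" "b \<in> U" | "a \<in> U" "b = x" | "a = x" "b = x"
      by blast
    then show "\<exists>p. ?path a b p"
    proof cases
      case 3
      then show ?thesis using new[of a] path_between_rev by metis
    next
      case 4
      then show ?thesis using path_between_singleton[of x "insert x U"] by auto
    qed (use old new in simp_all)
  qed
qed

text \<open>Nodes are attached one at a time from the end of the list, so a node that is met again
  does no harm. This turns paths and their pieces into candidate blocks.\<close>

lemma connected_set_successively:
  assumes "successively (\<lambda>x y. {x, y} \<in> E) p"
  shows "connected_set E (set p)"
  using assms
proof (induction p)
  case Nil
  then show ?case by (simp add: connected_set_empty)
next
  case (Cons x p)
  then show ?case
    by (cases p) (auto simp: connected_set_singleton intro: connected_set_insert)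
qed

text \<open>Supplies \<open>X\<close> such that all four sets in
  \<open>clique_vec_inclusion_exclusion\<close> are connected: each is the node set of a contiguous
  piece of the path. \<open>X\<close> is empty if the path is a single edge.\<close>

lemma path_interior:
  assumes "path_between V E a b p" and "a \<noteq> b"
  obtains X where "set p = X \<union> {a, b}" and "a \<notin> X" and "b \<notin> X"
    and "connected_set E X" and "connected_set E (insert a X)"
    and "connected_set E (insert b X)" and "connected_set E (X \<union> {a, b})"
proof -
  obtain q where q: "p = a # q @ [b]"
    using assms unfolding path_between_def
    by (metis append_butlast_last_id last_ConsL last_ConsR list.collapse)
  have s: "successively (\<lambda>x y. {x, y} \<in> E) (a # q @ [b])" and d: "distinct (a # q @ [b])"
    using assms(1) by (auto simp: path_between_def q)
  have "successively (\<lambda>x y. {x, y} \<in> E) q" "successively (\<lambda>x y. {x, y} \<in> E) (a # q)"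
    "successively (\<lambda>x y. {x, y} \<in> E) (q @ [b])"
    using s by (auto simp: successively_append_iff successively_Cons hd_append split: if_splits)
  from this[THEN connected_set_successively] connected_set_successively[OF s]
  have "connected_set E (set q)" "connected_set E (insert a (set q))"
    "connected_set E (insert b (set q))" "connected_set E (set q \<union> {a, b})"
    by (simp_all add: insert_commute)
  with that[of "set q"] d show ?thesis by (auto simp: q)
qed

text \<open>Transfers separation from paths to blocks: a path inside \<open>U\<close> is also a path
  of the whole graph.\<close>

lemma separating_connected_set:
  assumes "separating V E a b S" and "connected_set E U" and "U \<subseteq> V"
    and "a \<in> U" and "b \<in> U"
  shows "U \<inter> S \<noteq> {}"
proof -
  obtain p where p: "path_between U (induced_edges E U) a b p"
    using assms unfolding connected_graph_def by blast
  then have "path_between V E a b p"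
    using assms(3) by (rule path_between_mono) (auto simp: induced_edges_def)
  then have "set p \<inter> S \<noteq> {}"
    using assms(1) by (simp add: separating_def)
  moreover have "set p \<subseteq> U"
    using p by (simp add: path_between_def)
  ultimately show ?thesis by blast
qed

section \<open>Clique vectors and multicut vectors\<close>

lemma clique_vec_nth:
  "a \<noteq> b \<Longrightarrow> clique_vec U $ {a, b} = (if a \<in> U \<and> b \<in> U then 1 else 0)"
  by (simp add: clique_vec_def char_vec_def node_pairs_def indicator_def)

text \<open>The only pair inside \<open>X \<union> {a, b}\<close> that lies in neither
  \<open>insert a X\<close> nor \<open>insert b X\<close> is \<open>{a, b}\<close>; pairs inside
  \<open>X\<close> are subtracted twice and restored by the last term.\<close>

lemma clique_vec_inclusion_exclusion:
  assumes "a \<noteq> b" and "a \<notin> X" and "b \<notin> X"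
  shows "axis {a, b} 1
    = clique_vec (X \<union> {a, b}) - clique_vec (insert a X) - clique_vec (insert b X) + clique_vec X"
proof -
  have "axis {a, b} 1 $ e = (clique_vec (X \<union> {a, b}) - clique_vec (insert a X)
    - clique_vec (insert b X) + clique_vec X) $ e" for e :: "'a set"
  proof (cases "card e = 2")
    case True
    then obtain c d where "e = {c, d}" "c \<noteq> d" by (auto simp: card_2_iff)
    then show ?thesis
      using assms
      by (cases "c \<in> {a, b}"; cases "d \<in> {a, b}")
        (auto simp: clique_vec_nth axis_def doubleton_eq_iff)
  next
    case False
    then show ?thesis
      using assms(1) by (auto simp: clique_vec_def char_vec_def node_pairs_def axis_def indicator_def)
  qed
  then show ?thesis by (simp add: vec_eq_iff)
qed

lemma char_vec_lifted_multicut: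
  assumes "partition_on V P"
  shows "char_vec (lifted_multicut V P) = clique_vec V - (\<Sum>U\<in>P. clique_vec U)"
proof -
  have "char_vec (lifted_multicut V P) $ e = (clique_vec V - (\<Sum>U\<in>P. clique_vec U)) $ e"
    for e :: "'a set"
  proof (cases "e \<in> node_pairs V")
    case True
    then obtain a b where e: "e = {a, b}" "a \<noteq> b" and ab: "a \<in> V" "b \<in> V"
      by (auto simp: card_2_iff node_pairs_def)
    obtain A B where AB: "A \<in> P" "a \<in> A" "B \<in> P" "b \<in> B"
      using ab assms by (auto simp: partition_on_def)
    have uniq: "C = D" if "C \<in> P" "D \<in> P" "c \<in> C" "c \<in> D" for c C D
      using that assms by (auto simp: partition_on_def disjoint_def)
    \<comment> \<open>Blocks are disjoint, so only the block \<open>A\<close> of \<open>a\<close>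
      can contain the pair, and it does so iff it is also the block of \<open>b\<close>.\<close>
    have "(\<Sum>U\<in>P. clique_vec U $ e) = (\<Sum>U\<in>P. if U = A then (if A = B then 1 else 0) else 0)"
      using AB uniq by (intro sum.cong) (auto simp: e clique_vec_nth)
    also have "\<dots> = (if A = B then 1 else 0)"
      using AB by simp
    finally have s: "(\<Sum>U\<in>P. clique_vec U $ e) = (if A = B then 1 else 0)" .
    have "e \<in> lifted_multicut V P \<longleftrightarrow> A \<noteq> B"
      using True AB uniq unfolding lifted_multicut_def e(1)
      by (auto simp: doubleton_eq_iff) blast+
    then show ?thesis
      using ab by (simp add: s char_vec_def) (simp add: e clique_vec_nth indicator_def)
  next
    case False
    have "U \<subseteq> V" if "U \<in> P" for U
      using that assms by (auto simp: partition_on_def)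
    then have "clique_vec U $ e = 0" if "U \<in> P" for U
      using False that by (fastforce simp: clique_vec_def char_vec_def node_pairs_def indicator_def)
    moreover have "e \<notin> lifted_multicut V P"
      using False by (auto simp: lifted_multicut_def)
    ultimately show ?thesis
      using False by (simp add: char_vec_def clique_vec_def)
  qed
  then show ?thesis by (simp add: vec_eq_iff)
qed

lemma clique_vec_small: "U \<subseteq> {x} \<Longrightarrow> clique_vec U = 0"
  by (auto simp: clique_vec_def char_vec_def node_pairs_def vec_eq_iff card_2_iff indicator_def)

section \<open>Points of the polytope\<close>

lemma lifted_multicut_in_LMC:
  "decomposition V E P \<Longrightarrow> char_vec (lifted_multicut V P) \<in> LMC V E"
  unfolding LMC_def by (rule hull_inc) blast

text \<open>The witness is the decomposition into \<open>U\<close> and singletons; the singletons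
  contain no pairs.\<close>

lemma one_block_in_LMC:
  assumes "connected_set E U" and "U \<subseteq> V"
  shows "clique_vec V - clique_vec U \<in> LMC V E"
proof -
  let ?Q = "(\<lambda>x. {x}) ` (V - U)"
  \<comment> \<open>Blocks of a partition are nonempty, so an empty \<open>U\<close> must be left
    out.\<close>
  define P where "P = (if U = {} then ?Q else insert U ?Q)"
  have part: "partition_on V P"
    using assms(2) by (auto simp: P_def partition_on_def disjoint_def split: if_splits)
  then have "decomposition V E P"
    using assms(1) by (auto simp: decomposition_def P_def connected_set_singleton split: if_splits)
  moreover have "U \<notin> ?Q \<or> U = {}" by auto
  then have "(\<Sum>W\<in>P. clique_vec W) = clique_vec U"
    by (auto simp: P_def clique_vec_small sum.neutral)
  ultimately show ?thesis
    using lifted_multicut_in_LMC char_vec_lifted_multicut[OF part] by metis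
qed

theorem theorem6p11:
  fixes V :: "'a::finite set" and E :: "'a set set" and u u' v v' :: 'a
  assumes "simple_graph V E"
    and "connected_graph V E"
    and "{u, u'} \<in> E" and "{v, v'} \<in> E"
    and "distinct [u, u', v, v']"
  shows "((\<forall>x \<in> LMC V E. x $ {u, v} + x $ {u', v'} \<le> x $ {u, v'} + x $ {v, u'}) \<and>
          {x \<in> LMC V E. x $ {u, v} + x $ {u', v'} = x $ {u, v'} + x $ {v, u'}} facet_of LMC V E)
         \<longleftrightarrow> separating V E v u' {u, v'} \<and> separating V E u v' {v, u'}"
proof -

  \<comment> \<open>The linear form \<open>f\<close>, as inner product with \<open>w\<close>, on
    clique vectors\<close>
  let ?S = "LMC V E"
  define w :: "real ^ ('a set)" where
    "w = axis {u, v} 1 + axis {u', v'} 1 - axis {u, v'} 1 - axis {v, u'} 1"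
  define F where "F = ?S \<inter> {x. w \<bullet> x = 0}"
  have w: "w \<bullet> x = x $ {u, v} + x $ {u', v'} - x $ {u, v'} - x $ {v, u'}" for x
    by (simp add: w_def inner_axis' algebra_simps)
  have dist: "u \<noteq> u'" "u \<noteq> v" "u \<noteq> v'" "u' \<noteq> v" "u' \<noteq> v'" "v \<noteq> v'"
    using assms(5) by auto
  have inV: "u \<in> V" "u' \<in> V" "v \<in> V" "v' \<in> V"
    using assms(1,3,4) by (auto simp: simple_graph_def node_pairs_def)
  \<comment> \<open>With 0/1 membership indicators the value factors as
    \<open>([u] - [u']) * ([v] - [v'])\<close>. So it is -1 iff \<open>U\<close> meets the four
    nodes in \<open>{u, v'}\<close> or \<open>{v, u'}\<close>, 1 iff in \<open>{u, v}\<close> or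
    \<open>{u', v'}\<close>, and 0 otherwise.\<close>
  have w_clique: "w \<bullet> clique_vec U =
      of_bool (u \<in> U \<and> v \<in> U) + of_bool (u' \<in> U \<and> v' \<in> U)
      - of_bool (u \<in> U \<and> v' \<in> U) - of_bool (v \<in> U \<and> u' \<in> U)" for U
    using dist by (simp add: w clique_vec_nth)
  \<comment> \<open>Hence at a multicut vector the form is minus the sum of its values on the
    blocks.\<close>
  have w_V: "w \<bullet> clique_vec V = 0"
    using inV by (simp add: w_clique)
  have E_on_V: "induced_edges E V = E"
    using assms(1) by (auto simp: induced_edges_def simple_graph_def node_pairs_def)
  have valid_iff: "(\<forall>x \<in> ?S. x $ {u, v} + x $ {u', v'} \<le> x $ {u, v'} + x $ {v, u'})
      \<longleftrightarrow> (\<forall>x \<in> ?S. w \<bullet> x \<le> 0)"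
    by (simp add: w algebra_simps)
  have F_eq: "{x \<in> ?S. x $ {u, v} + x $ {u', v'} = x $ {u, v'} + x $ {v, u'}} = F"
    by (auto simp: F_def w algebra_simps)

  \<comment> \<open>Validity implies separation\<close>
  have necessary: "separating V E v u' {u, v'} \<and> separating V E u v' {v, u'}"
    if valid: "\<forall>x \<in> ?S. w \<bullet> x \<le> 0"
  proof -
    have nonneg: "w \<bullet> clique_vec (set p) \<ge> 0" if "path_between V E a b p" for a b p
    proof -
      have "clique_vec V - clique_vec (set p) \<in> ?S"
        using that by (auto simp: path_between_def intro!: one_block_in_LMC connected_set_successively)
      then show ?thesis
        using valid w_V by (fastforce simp: inner_diff_right)
    qed
    have ends: "a \<in> set p" "b \<in> set p" if "path_between V E a b p" for a b p
      using that by (auto simp: path_between_def)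
    \<comment> \<open>A path avoiding both nodes would be a block of value -1.\<close>
    have "set p \<inter> {u, v'} \<noteq> {}" if "path_between V E v u' p" for p
      using nonneg[OF that] ends[OF that] by (auto simp: w_clique of_bool_def split: if_splits)
    moreover have "set p \<inter> {v, u'} \<noteq> {}" if "path_between V E u v' p" for p
      using nonneg[OF that] ends[OF that] by (auto simp: w_clique of_bool_def split: if_splits)
    ultimately show ?thesis
      using inV by (simp add: separating_def)
  qed

  \<comment> \<open>Separation implies validity and the facet property\<close>
  have sufficient: "(\<forall>x \<in> ?S. w \<bullet> x \<le> 0) \<and> F facet_of ?S"
    if sep: "separating V E v u' {u, v'}" "separating V E u v' {v, u'}"
  proof -
    \<comment> \<open>Exactly the two intersections of value -1 are excluded.\<close>
    have block: "v \<in> U \<Longrightarrow> u' \<in> U \<Longrightarrow> u \<in> U \<or> v' \<in> U"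
      "u \<in> U \<Longrightarrow> v' \<in> U \<Longrightarrow> v \<in> U \<or> u' \<in> U"
      if "connected_set E U" "U \<subseteq> V" for U
      using sep[THEN separating_connected_set, OF that] by auto
    have w_nonneg: "w \<bullet> clique_vec U \<ge> 0" if "connected_set E U" "U \<subseteq> V" for U
      using block[OF that] by (auto simp: w_clique)
    have valid: "w \<bullet> x \<le> 0" if "x \<in> ?S" for x
    proof -
      have "w \<bullet> char_vec (lifted_multicut V P) \<le> 0" if P: "decomposition V E P" for P
      proof -
        have part: "partition_on V P" and "\<And>U. U \<in> P \<Longrightarrow> connected_set E U"
          using P by (auto simp: decomposition_def)
        moreover have "\<And>U. U \<in> P \<Longrightarrow> U \<subseteq> V"
          using part by (auto simp: partition_on_def)
        ultimately have "0 \<le> (\<Sum>U\<in>P. w \<bullet> clique_vec U)"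
          by (intro sum_nonneg w_nonneg)
        then show ?thesis
          by (simp add: char_vec_lifted_multicut[OF part] inner_diff_right inner_sum_right w_V)
      qed
      then have "?S \<subseteq> {x. w \<bullet> x \<le> 0}"
        unfolding LMC_def by (intro hull_minimal convex_halfspace_le) auto
      with that show ?thesis by blast
    qed
    have face: "F face_of ?S"
      unfolding F_def using valid
      by (intro face_of_Int_supporting_hyperplane_le) (auto simp: LMC_def)
    \<comment> \<open>The decomposition into singletons.\<close>
    have one_in_F: "clique_vec V \<in> F"
      using one_block_in_LMC[OF connected_set_empty, of V E]
      by (simp add: F_def w_V clique_vec_small)
    \<comment> \<open>The decomposition with the single block \<open>V\<close>. Since the origin
      lies in \<open>F\<close>, affine and linear dimensions agree for both \<open>F\<close> and the
      polytope.\<close>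
    have zero_in_F: "0 \<in> F"
      using one_block_in_LMC[where E = E and U = V and V = V] assms(2) by (simp add: F_def E_on_V)
    have in_span_S: "clique_vec U \<in> span ?S" if "connected_set E U" "U \<subseteq> V" for U
    proof -
      have "clique_vec V - (clique_vec V - clique_vec U) \<in> span ?S"
        using one_in_F one_block_in_LMC[OF that] by (intro span_diff span_base) (auto simp: F_def)
      then show ?thesis by simp
    qed
    have "F \<noteq> ?S"
    proof
      assume "F = ?S"
      then have "span ?S \<subseteq> {x. w \<bullet> x = 0}"
        by (intro span_minimal subspace_hyperplane) (auto simp: F_def)
      moreover obtain p where p: "path_between V E u v p"
        using assms(2) inV by (auto simp: connected_graph_def)
      have "axis {u, v} 1 \<in> span ?S"
      proof (rule path_interior[OF p dist(2)])
        fix X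
        assume X: "set p = X \<union> {u, v}" "u \<notin> X" "v \<notin> X" "connected_set E X"
          "connected_set E (insert u X)" "connected_set E (insert v X)"
          "connected_set E (X \<union> {u, v})"
        have "X \<union> {u, v} \<subseteq> V"
          using p X(1) by (auto simp: path_between_def)
        then show ?thesis
          unfolding clique_vec_inclusion_exclusion[OF dist(2) X(2,3)]
          using X(4-7) by (intro span_add span_diff in_span_S) auto
      qed
      ultimately have "w \<bullet> axis {u, v} 1 = 0" by blast
      then show False
        using dist by (auto simp: w axis_def doubleton_eq_iff)
    qed
    \<comment> \<open>One vector beyond \<open>F\<close> raises the dimension by at most one, so it
      suffices that \<open>T\<close> contains the polytope.\<close>
    define T where "T = span (insert (axis {u', v'} 1) F)"
    have T: "subspace T" by (simp add: T_def)
    have tight: "clique_vec U \<in> T" if "connected_set E U" "U \<subseteq> V" "w \<bullet> clique_vec U = 0" for U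
    proof -
      have "clique_vec V - clique_vec U \<in> F"
        using one_block_in_LMC[OF that(1,2)] that(3) w_V by (simp add: F_def inner_diff_right)
      then have "clique_vec V - (clique_vec V - clique_vec U) \<in> T"
        unfolding T_def using one_in_F by (intro span_diff span_base) auto
      then show ?thesis by simp
    qed
    have type_uv: "clique_vec U \<in> T"
      if U: "connected_set E U" "U \<subseteq> V" and "u \<in> U" "v \<in> U" "u' \<notin> U" "v' \<notin> U" for U
    proof -
      have u': "connected_set E (insert u' U)" and v': "connected_set E (insert v' U)"
        using U that assms(3,4) by (auto intro: connected_set_insert simp: insert_commute)
      have u'v': "connected_set E (U \<union> {u', v'})"
        using connected_set_insert[OF v', of u u'] that assms(3) by (simp add: insert_commute)
      \<comment> \<open>The three enlarged sets contain at least three of the four nodes, so the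
        form vanishes on them and \<open>tight\<close> applies.\<close>
      have "axis {u', v'} 1 - clique_vec (U \<union> {u', v'})
          + clique_vec (insert u' U) + clique_vec (insert v' U) \<in> T"
      proof (intro subspace_add[OF T] subspace_diff[OF T])
        show "axis {u', v'} 1 \<in> T" by (simp add: T_def span_base)
      qed (use u' v' u'v' inV that dist in \<open>auto intro!: tight simp: w_clique\<close>)
      then show ?thesis
        using clique_vec_inclusion_exclusion[of u' v' U] that dist by (simp add: algebra_simps)
    qed
    have type_uv': "clique_vec U \<in> T"
      if U: "connected_set E U" "U \<subseteq> V" and mem: "u \<notin> U" "v \<notin> U" "u' \<in> U" "v' \<in> U" for U
    proof -
      \<comment> \<open>Only a difference is obtained here, because \<open>T\<close> was generated
        with the other unit vector. Using this for two choices of \<open>W\<close> settles the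
        case.\<close>
      have extend: "axis {u, v} 1 - clique_vec W \<in> T"
        if W: "connected_set E W" "W \<subseteq> V" "u \<notin> W" "v \<notin> W" "u' \<in> W" "v' \<in> W" for W
      proof -
        have u: "connected_set E (insert u W)" and v: "connected_set E (insert v W)"
          using W assms(3,4) by (auto intro: connected_set_insert)
        have uv: "connected_set E (W \<union> {u, v})"
          using connected_set_insert[OF v, of u' u] W assms(3) by simp
        have "clique_vec (W \<union> {u, v}) - clique_vec (insert u W) - clique_vec (insert v W) \<in> T"
          using u v uv inV W dist
          by (intro subspace_diff[OF T]) (auto intro!: tight simp: w_clique)
        then show ?thesis
          using clique_vec_inclusion_exclusion[of u v W] W dist by simp
      qed
      \<comment> \<open>Staying inside \<open>U\<close> keeps the path away from \<open>u\<close>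
        and \<open>v\<close>.\<close>
      obtain p where p: "path_between U (induced_edges E U) u' v' p"
        using U(1) mem unfolding connected_graph_def by blast
      then have pV: "path_between V E u' v' p"
        using U(2) by (rule path_between_mono) (auto simp: induced_edges_def)
      have "axis {u, v} 1 \<in> T"
      proof (rule path_interior[OF pV dist(5)])
        fix X
        assume X: "set p = X \<union> {u', v'}" "u' \<notin> X" "v' \<notin> X" "connected_set E X"
          "connected_set E (insert u' X)" "connected_set E (insert v' X)"
          "connected_set E (X \<union> {u', v'})"
        have XU: "X \<union> {u', v'} \<subseteq> U"
          using p X(1) by (auto simp: path_between_def)
        then have nX: "u \<notin> X" "v \<notin> X" and XV: "X \<subseteq> V"
          using mem U(2) by auto
        \<comment> \<open>These sets contain at most one of the four nodes, so all are tight. Thus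
          the clique vector of the path lies in \<open>T\<close>, and \<open>extend\<close> for the
          path then yields the unit vector of \<open>{u, v}\<close>.\<close>
        have "axis {u', v'} 1 + clique_vec (insert u' X) + clique_vec (insert v' X)
            - clique_vec X \<in> T"
        proof (intro subspace_add[OF T] subspace_diff[OF T])
          show "axis {u', v'} 1 \<in> T" by (simp add: T_def span_base)
        qed (use X nX XV inV dist in \<open>auto intro!: tight simp: w_clique\<close>)
        then have "clique_vec (X \<union> {u', v'}) \<in> T"
          using clique_vec_inclusion_exclusion[OF dist(5) X(2,3)] by (simp add: algebra_simps)
        moreover have "axis {u, v} 1 - clique_vec (X \<union> {u', v'}) \<in> T"
          using X(7) XU U(2) nX dist by (intro extend) auto
        ultimately have "axis {u, v} 1 - clique_vec (X \<union> {u', v'}) + clique_vec (X \<union> {u', v'}) \<in> T"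
          by (intro subspace_add[OF T])
        then show ?thesis by simp
      qed
      then have "axis {u, v} 1 - (axis {u, v} 1 - clique_vec U) \<in> T"
        using extend[OF U mem] by (rule subspace_diff[OF T])
      then show ?thesis by simp
    qed
    have in_T: "clique_vec U \<in> T" if U: "connected_set E U" "U \<subseteq> V" for U
    proof (cases "w \<bullet> clique_vec U = 0")
      case True
      then show ?thesis using tight U by blast
    next
      case False
      then have "u \<in> U \<and> v \<in> U \<and> u' \<notin> U \<and> v' \<notin> U \<or> u \<notin> U \<and> v \<notin> U \<and> u' \<in> U \<and> v' \<in> U"
        using block[OF U] by (auto simp: w_clique of_bool_def split: if_splits)
      then show ?thesis using type_uv type_uv' U by blast
    qed
    have "?S \<subseteq> T"
      unfolding LMC_def
    proof (rule hull_minimal)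
      show "convex T" using T by (rule subspace_imp_convex)
      show "{char_vec (lifted_multicut V P) |P. decomposition V E P} \<subseteq> T"
      proof clarify
        fix P
        assume P: "decomposition V E P"
        then have part: "partition_on V P" by (simp add: decomposition_def)
        have "clique_vec U \<in> T" if "U \<in> P" for U
          using P that by (intro in_T) (auto simp: decomposition_def partition_on_def)
        then show "char_vec (lifted_multicut V P) \<in> T"
          unfolding char_vec_lifted_multicut[OF part] T_def
          using one_in_F by (intro span_diff span_sum) (auto intro: span_base)
      qed
    qed
    then have "dim ?S \<le> dim (insert (axis {u', v'} 1) F)"
      unfolding T_def by (metis dim_span dim_subset)
    also have "\<dots> \<le> dim F + 1"
      by (simp add: dim_insert)
    finally have "dim ?S \<le> dim F + 1" .
    moreover have "aff_dim ?S = int (dim ?S)" "aff_dim F = int (dim F)"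
      using zero_in_F by (auto simp: F_def intro!: aff_dim_zero hull_inc)
    \<comment> \<open>A proper face loses at least one dimension; the span bound allows no
      more.\<close>
    moreover have "aff_dim F < aff_dim ?S"
      using face \<open>F \<noteq> ?S\<close> by (intro face_of_aff_dim_lt) (auto simp: LMC_def)
    ultimately have "aff_dim F = aff_dim ?S - 1" by linarith
    then show ?thesis
      using valid face zero_in_F by (auto simp: facet_of_def)
  qed
  show ?thesis
    unfolding valid_iff F_eq using necessary sufficient by blast
qed

end
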